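(* Let $\mathcal{L} \subseteq \mathbb{S}^n$ be a linear subspace, let $C, Y \in \mathbb{S}^n$, and let $\mathcal{S} \subseteq \mathbb{S}^n$ be a subspace whose orthogonal projection $P_{\mathcal{S}} : \mathbb{S}^n \to \mathbb{S}^n$ satisfies the Constraint Set Invariance Conditions for $(C, Y, \mathcal{L})$. Then, treating $\mathcal{S}$ as the ambient space, the pair of optimization problems $$\text{minimize } P_{\mathcal{S}}(C)\cdot X \ \text{ subject to } X \in P_{\mathcal{S}}(Y) + \mathcal{L}\cap\mathcal{S},\ X \in \mathbb{S}^n_{+}\cap\mathcal{S},$$ $$\text{maximize } -P_{\mathcal{S}}(Y)\cdot S \ \text{ subject to } S \in P_{\mathcal{S}}(C) + \mathcal{L}^{\perp}\cap\mathcal{S},\ S \in \mathbb{S}^n_{+}\cap\mathcal{S}$$ is a primal-dual pair, i.e., $$(\mathbb{S}^n_{+}\cap\mathcal{S})^{*}\cap\mathcal{S} = \mathbb{S}^n_{+}\cap\mathcal{S}, \qquad (\mathcal{L}\cap\mathcal{S})^{\perp}\cap\mathcal{S} = \mathcal{L}^{\perp}\cap\mathcal{S}.$$ Moreover, $$(Y+\mathcal{L})\cap\mathcal{S} = P_{\mathcal{S}}(Y) + \mathcal{L}\cap\mathcal{S}, \qquad (C+\mathcal{L}^{\perp})\cap\mathcal{S} = P_{\mathcal{S}}(C) + \mathcal{L}^{\perp}\cap\mathcal{S}.$$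
   Context: $\mathbb{S}^n$ is the space of real symmetric $n\times n$ matrices with the trace inner product $X\cdot Y := \mathrm{Tr}(XY)$; $\mathbb{S}^n_+$ is the positive semidefinite cone; $P_{\mathcal{S}}$ is the orthogonal projection onto $\mathcal{S}$. For $\mathcal{T}\subseteq\mathbb{S}^n$, $\mathcal{T}^* := \{X\in\mathbb{S}^n : X\cdot Z\ge 0\ \forall Z\in\mathcal{T}\}$ is the dual cone and, for a subspace, $\perp$ is the orthogonal complement, both taken in $\mathbb{S}^n$. Constraint Set Invariance Conditions: $P_{\mathcal{S}}$ satisfies them if (a) $P_{\mathcal{S}}(\mathbb{S}^n_+)\subseteq \mathbb{S}^n_+$; (b) $P_{\mathcal{S}}(Y+\mathcal{L})\subseteq Y+\mathcal{L}$; (c) $P_{\mathcal{S}}(C+\mathcal{L}^\perp)\subseteq C+\mathcal{L}^\perp$. *)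

theory Defs
  imports "HOL-Analysis.Analysis"
begin

definition sym_mats :: "(real^'n^'n) set" where
  "sym_mats = {X. transpose X = X}"

definition psd_cone :: "(real^'n^'n) set" where
  "psd_cone = {X \<in> sym_mats. \<forall>v. 0 \<le> v \<bullet> (X *v v)}"

definition trace_inner :: "real^'n^'n \<Rightarrow> real^'n^'n \<Rightarrow> real"  (infixl "\<bullet>\<^sub>t" 70) where
  "X \<bullet>\<^sub>t Y = trace (X ** Y)"

text \<open>The form \<open>trace (X ** Y)\<close> is not positive definite on all square matrices; on
  symmetric matrices it is the inner product inherited from \<^typ>\<open>real^'n^'n\<close>.\<close>

lemma trace_inner_eq_inner:
  assumes "X \<in> sym_mats"
  shows "X \<bullet>\<^sub>t Y = X \<bullet> Y"
proof -
  have "X $ i $ j = X $ j $ i" for i j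
    using assms by (simp add: sym_mats_def transpose_def vec_eq_iff)
  then show ?thesis
    unfolding trace_inner_def trace_def matrix_matrix_mult_def inner_vec_def
    by (simp, subst sum.swap) (simp cong: sum.cong)
qed

definition dual_cone :: "(real^'n^'n) set \<Rightarrow> (real^'n^'n) set" where
  "dual_cone T = {X \<in> sym_mats. \<forall>Z\<in>T. 0 \<le> X \<bullet>\<^sub>t Z}"

definition sym_perp :: "(real^'n^'n) set \<Rightarrow> (real^'n^'n) set" where
  "sym_perp L = {X \<in> sym_mats. \<forall>Z\<in>L. X \<bullet>\<^sub>t Z = 0}"

text \<open>Meaningful for a subspace \<open>S\<close> of \<^const>\<open>sym_mats\<close> and a symmetric \<open>X\<close>; see \<open>ex1_orth_proj\<close>.\<close>

definition orth_proj :: "(real^'n^'n) set \<Rightarrow> real^'n^'n \<Rightarrow> real^'n^'n" where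
  "orth_proj S X = (THE Z. Z \<in> S \<and> (\<forall>W\<in>S. (X - Z) \<bullet>\<^sub>t W = 0))"

lemma ex1_orth_proj:
  assumes "subspace S" "S \<subseteq> sym_mats" "X \<in> sym_mats"
  shows "\<exists>!Z. Z \<in> S \<and> (\<forall>W\<in>S. (X - Z) \<bullet>\<^sub>t W = 0)"
proof -
  have eq: "(X - Z) \<bullet>\<^sub>t W = (X - Z) \<bullet> W" if "Z \<in> S" for Z W
  proof (rule trace_inner_eq_inner)
    have "transpose Z = Z" "transpose X = X"
      using that assms by (auto simp: sym_mats_def)
    then show "X - Z \<in> sym_mats"
      by (simp add: sym_mats_def transpose_def vec_eq_iff)
  qed
  obtain Z U where Z: "Z \<in> span S" "\<And>w. w \<in> span S \<Longrightarrow> orthogonal U w" "X = Z + U"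
    using orthogonal_subspace_decomp_exists by metis
  have S: "span S = S"
    using assms(1) by (simp add: span_eq_iff)
  show ?thesis
  proof (rule ex1I[of _ Z])
    have "(X - Z) \<bullet>\<^sub>t W = 0" if "W \<in> S" for W
      using Z that S eq[of Z W] by (simp add: orthogonal_def)
    then show "Z \<in> S \<and> (\<forall>W\<in>S. (X - Z) \<bullet>\<^sub>t W = 0)"
      using Z S by simp
  next
    fix Z' assume Z': "Z' \<in> S \<and> (\<forall>W\<in>S. (X - Z') \<bullet>\<^sub>t W = 0)"
    have d: "Z' - Z \<in> S"
      using Z' Z S assms(1) by (simp add: subspace_diff)
    have "(X - Z') \<bullet> (Z' - Z) = 0"
      using Z' d eq by auto
    moreover have "(X - Z) \<bullet> (Z' - Z) = 0"
      using Z d S by (simp add: orthogonal_def)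
    ultimately have "(Z' - Z) \<bullet> (Z' - Z) = 0"
      by (simp add: inner_diff_left)
    then show "Z' = Z" by simp
  qed
qed

definition constraint_set_invariance ::
  "(real^'n^'n \<Rightarrow> real^'n^'n) \<Rightarrow> real^'n^'n \<Rightarrow> real^'n^'n \<Rightarrow> (real^'n^'n) set \<Rightarrow> bool" where
  "constraint_set_invariance P C Y L \<longleftrightarrow>
     P ` psd_cone \<subseteq> psd_cone \<and>
     P ` ((+) Y ` L) \<subseteq> (+) Y ` L \<and>
     P ` ((+) C ` sym_perp L) \<subseteq> (+) C ` sym_perp L"

text \<open>\<open>Minimize A B M K\<close> is the problem: minimize \<open>A \<bullet>\<^sub>t X\<close> subject to \<open>X \<in> (+) B ` M\<close> and \<open>X \<in> K\<close>;
  \<open>Maximize A B M K\<close> is the maximization problem with the same data.\<close>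

datatype 'v conic_program =
    Minimize 'v 'v "'v set" "'v set"
  | Maximize 'v 'v "'v set" "'v set"

text \<open>Conic duality with ambient space \<open>V\<close>, a subspace of \<^const>\<open>sym_mats\<close>: all data lie in \<open>V\<close>, and
  the dual of ``minimize \<open>A \<bullet>\<^sub>t X\<close> over \<open>(B + M) \<inter> K\<close>'' is ``maximize \<open>- B \<bullet>\<^sub>t S\<close> over
  \<open>(A + M') \<inter> K'\<close>'', where \<open>M'\<close> and \<open>K'\<close> are the orthogonal complement of \<open>M\<close> and the dual cone
  of \<open>K\<close>, both taken within \<open>V\<close>.\<close>

fun primal_dual_pair ::
  "(real^'n^'n) set \<Rightarrow> (real^'n^'n) conic_program \<Rightarrow> (real^'n^'n) conic_program \<Rightarrow> bool" where
  "primal_dual_pair V (Minimize A B M K) (Maximize A' B' M' K') \<longleftrightarrow>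
     A \<in> V \<and> B \<in> V \<and> subspace M \<and> M \<subseteq> V \<and> K \<subseteq> V \<and>
     A' = - B \<and> B' = A \<and> dual_cone K \<inter> V = K' \<and> sym_perp M \<inter> V = M'"
| "primal_dual_pair V _ _ \<longleftrightarrow> False"

end

theory Submission
  imports Defs
begin

text \<open>The projection \<open>P\<close> onto \<open>S\<close> maps \<open>L\<close>, its complement and the positive semidefinite cone into
  themselves, and it is self-adjoint. Hence for \<open>X\<close> in \<open>S\<close>, testing \<open>X\<close> against some \<open>Z\<close> is the same
  as testing it against \<open>P Z\<close>, so restricting the test set to \<open>S\<close> loses nothing. The remaining
  ingredient is the self-duality of the positive semidefinite cone: any of its members is reduced to
  \<open>0\<close> by subtracting rank-one matrices, as in the Cholesky decomposition.\<close>

lemma subspace_sym_mats: "subspace (sym_mats :: (real^'n^'n) set)"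
  by (auto simp: subspace_def sym_mats_def transpose_def vec_eq_iff)

lemma subspace_sym_perp: "subspace (sym_perp L)"
proof -
  have "sym_perp L = {X \<in> sym_mats. \<forall>Z\<in>L. X \<bullet> Z = 0}"
    by (auto simp: sym_perp_def trace_inner_eq_inner)
  then show ?thesis
    using subspace_sym_mats by (auto simp: subspace_def inner_left_distrib)
qed

text \<open>The rank-one matrix v v^T. Pairing it with a matrix evaluates that matrix's quadratic
  form at \<open>v\<close>, so it serves both as a test for semidefiniteness and as the term removed
  in an elimination step.\<close>

definition outer_square :: "real^'n \<Rightarrow> real^'n^'n" where
  "outer_square v = (\<chi> i j. v $ i * v $ j)"

lemma inner_outer_square: "X \<bullet> outer_square v = v \<bullet> (X *v v)"
  by (simp add: outer_square_def inner_vec_def matrix_vector_mult_def sum_distrib_left mult_ac)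

lemma outer_square_mult: "outer_square w *v v = (w \<bullet> v) *\<^sub>R w"
  by (simp add: outer_square_def vec_eq_iff matrix_vector_mult_def inner_vec_def
      sum_distrib_left mult_ac)

lemma outer_square_sym: "outer_square v \<in> sym_mats"
  by (simp add: outer_square_def sym_mats_def transpose_def vec_eq_iff mult.commute)

lemma outer_square_psd: "outer_square v \<in> psd_cone"
  by (simp add: psd_cone_def outer_square_sym outer_square_mult inner_commute)

lemma quadratic_axis:
  fixes Z :: "real^'n^'n"
  shows "axis i 1 \<bullet> (Z *v axis i 1) = Z $ i $ i"
  by (simp add: inner_axis' matrix_vector_mul_component inner_axis)

lemma psd_diag_nonneg: "Z \<in> psd_cone \<Longrightarrow> 0 \<le> Z $ i $ i"
  by (metis (no_types, lifting) mem_Collect_eq psd_cone_def quadratic_axis)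

text \<open>Symmetry merges the two cross terms, leaving a quadratic polynomial in \<open>t\<close>.
  Its sign for particular \<open>t\<close> kills off-diagonal entries, and its minimum over
  \<open>t\<close> gives the Schur complement.\<close>

lemma quadratic_add_axis:
  fixes Z :: "real^'n^'n"
  assumes "Z \<in> sym_mats"
  shows "(v + t *\<^sub>R axis i 1) \<bullet> (Z *v (v + t *\<^sub>R axis i 1)) =
    v \<bullet> (Z *v v) + 2 * t * (Z $ i \<bullet> v) + t\<^sup>2 * Z $ i $ i"
proof -
  have "transpose Z = Z" using assms by (simp add: sym_mats_def)
  then have "v \<bullet> (Z *v axis i 1) = axis i 1 \<bullet> (Z *v v)"
    by (metis dot_lmul_matrix inner_commute transpose_matrix_vector)
  moreover have "axis i 1 \<bullet> (Z *v v) = Z $ i \<bullet> v"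
    by (simp add: inner_axis' matrix_vector_mul_component)
  ultimately show ?thesis
    using quadratic_axis[of i Z]
    by (simp add: matrix_vector_right_distrib matrix_vector_mult_scaleR inner_left_distrib
        inner_right_distrib power2_eq_square algebra_simps)
qed

text \<open>With a vanishing diagonal the quadratic form is linear in \<open>t\<close> along
  \<open>axis j 1 + t *\<^sub>R axis i 1\<close>; being nonnegative for both signs of
  \<open>t\<close>, it has slope zero.\<close>

lemma psd_zero_diag:
  fixes Z :: "real^'n^'n"
  assumes "Z \<in> psd_cone" "\<And>i. Z $ i $ i = 0"
  shows "Z = 0"
proof -
  have "Z $ i $ j = 0" for i j
  proof -
    have "0 \<le> (axis j 1 + t *\<^sub>R axis i 1) \<bullet> (Z *v (axis j 1 + t *\<^sub>R axis i 1))" for t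
      using assms(1) by (simp add: psd_cone_def)
    then have "0 \<le> 2 * t * Z $ i $ j" for t
      using assms quadratic_add_axis[of Z "axis j 1" _ i]
      by (simp add: psd_cone_def quadratic_axis inner_axis)
    from this[of 1] this[of "-1"] show ?thesis by simp
  qed
  then show ?thesis by (simp add: vec_eq_iff)
qed

text \<open>One elimination step with pivot \<open>Z $ i $ i\<close>: each value of the new
  quadratic form is a value of the old one at a shifted vector.\<close>

lemma psd_schur_complement:
  fixes Z :: "real^'n^'n"
  assumes "Z \<in> psd_cone" "0 < Z $ i $ i"
  shows "Z - (1 / Z $ i $ i) *\<^sub>R outer_square (Z $ i) \<in> psd_cone"
proof -
  let ?Z' = "Z - (1 / Z $ i $ i) *\<^sub>R outer_square (Z $ i)"
  have sym: "Z \<in> sym_mats" using assms(1) by (simp add: psd_cone_def)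
  have "0 \<le> v \<bullet> (?Z' *v v)" for v
  proof -
    \<comment> \<open>\<open>w\<close> minimizes the quadratic form of \<open>Z\<close> over \<open>v + span {axis i 1}\<close>.\<close>
    define w where "w = v + (- (Z $ i \<bullet> v) / Z $ i $ i) *\<^sub>R axis i 1"
    have "w \<bullet> (Z *v w) = v \<bullet> (Z *v v) - (Z $ i \<bullet> v)\<^sup>2 / Z $ i $ i"
      unfolding w_def quadratic_add_axis[OF sym]
      using assms(2) by (simp add: field_simps power2_eq_square)
    also have "\<dots> = v \<bullet> (?Z' *v v)"
      by (simp add: matrix_vector_mult_diff_rdistrib scaleR_matrix_vector_assoc[symmetric]
          outer_square_mult inner_diff_right inner_commute power2_eq_square)
    finally show ?thesis
      using assms(1) by (metis (no_types, lifting) mem_Collect_eq psd_cone_def)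
  qed
  moreover have "?Z' \<in> sym_mats"
    by (intro subspace_diff subspace_scale subspace_sym_mats sym outer_square_sym)
  ultimately show ?thesis by (simp add: psd_cone_def)
qed

text \<open>Induction on the number of nonzero diagonal entries of \<open>Z\<close>. Each pivot
  lowers this number, and the rank-one term it removes pairs with \<open>X\<close> to a value of the
  quadratic form of \<open>X\<close>.\<close>

lemma psd_inner_nonneg:
  fixes X Z :: "real^'n^'n"
  assumes "X \<in> psd_cone" "Z \<in> psd_cone"
  shows "0 \<le> X \<bullet> Z"
  using assms(2)
proof (induction "card {i. Z $ i $ i \<noteq> 0}" arbitrary: Z rule: less_induct)
  case less
  show ?case
  proof (cases "\<forall>i. Z $ i $ i = 0")
    case True
    then have "Z = 0" using less.prems by (simp add: psd_zero_diag)
    then show ?thesis by simp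
  next
    case False
    then obtain i where "Z $ i $ i \<noteq> 0" by blast
    with psd_diag_nonneg[OF less.prems] have i: "0 < Z $ i $ i"
      by (metis less_le)
    define Z' where "Z' = Z - (1 / Z $ i $ i) *\<^sub>R outer_square (Z $ i)"
    have psd: "Z' \<in> psd_cone"
      unfolding Z'_def by (rule psd_schur_complement[OF less.prems i])
    have diag: "Z' $ j $ j = Z $ j $ j - (Z $ i $ j)\<^sup>2 / Z $ i $ i" for j
      by (simp add: Z'_def outer_square_def power2_eq_square)
    \<comment> \<open>Elimination creates no new nonzero diagonal entry: the subtraction cannot
      raise a zero entry, and semidefiniteness keeps it from becoming negative.\<close>
    have "Z' $ j $ j = 0" if "Z $ j $ j = 0" for j
    proof (rule antisym)
      show "Z' $ j $ j \<le> 0" using that i by (simp add: diag)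
    qed (rule psd_diag_nonneg[OF psd])
    moreover have "Z' $ i $ i = 0" using i by (simp add: diag power2_eq_square)
    ultimately have "{j. Z' $ j $ j \<noteq> 0} \<subset> {j. Z $ j $ j \<noteq> 0}"
      using i by force
    then have "0 \<le> X \<bullet> Z'"
      by (intro less.hyps psd psubset_card_mono) simp_all
    moreover have "0 \<le> X \<bullet> outer_square (Z $ i)"
      using assms(1) by (simp add: inner_outer_square psd_cone_def)
    moreover have "X \<bullet> Z = X \<bullet> Z' + (1 / Z $ i $ i) * (X \<bullet> outer_square (Z $ i))"
      by (simp add: Z'_def inner_diff_right)
    ultimately show ?thesis using i by simp
  qed
qed

text \<open>The residual \<open>X - orth_proj S X\<close> is symmetric, so its orthogonality to
  \<open>S\<close> in the trace form carries over to the Euclidean inner product. The second claim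
  is the form in which self-adjointness is used below.\<close>

lemma orth_proj:
  assumes "subspace S" "S \<subseteq> sym_mats" "X \<in> sym_mats"
  shows orth_proj_in: "orth_proj S X \<in> S"
    and orth_proj_inner: "W \<in> S \<Longrightarrow> W \<bullet> orth_proj S X = W \<bullet> X"
proof -
  have P: "orth_proj S X \<in> S \<and> (\<forall>W\<in>S. (X - orth_proj S X) \<bullet>\<^sub>t W = 0)"
    unfolding orth_proj_def by (rule theI'[OF ex1_orth_proj[OF assms]])
  then show "orth_proj S X \<in> S" by blast
  then have "X - orth_proj S X \<in> sym_mats"
    using assms by (blast intro: subspace_diff subspace_sym_mats)
  then show "W \<bullet> orth_proj S X = W \<bullet> X" if "W \<in> S"
    using P that by (auto simp: trace_inner_eq_inner inner_diff_left inner_commute[of W])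
qed

text \<open>The difference of the two candidates lies in \<open>S\<close> and is orthogonal to
  \<open>S\<close>, hence to itself.\<close>

lemma orth_proj_eqI:
  assumes S: "subspace S" "S \<subseteq> sym_mats" and X: "X \<in> sym_mats"
    and Z: "Z \<in> S" "\<And>W. W \<in> S \<Longrightarrow> W \<bullet> Z = W \<bullet> X"
  shows "orth_proj S X = Z"
proof -
  have "orth_proj S X - Z \<in> S"
    using S(1) orth_proj_in[OF S X] Z(1) by (rule subspace_diff)
  then have "(orth_proj S X - Z) \<bullet> (orth_proj S X - Z) = 0"
    using orth_proj_inner[OF S X] Z(2) by (simp add: inner_diff_right)
  then show ?thesis by simp
qed

lemma orth_proj_add:
  assumes S: "subspace S" "S \<subseteq> sym_mats" and "A \<in> sym_mats" "B \<in> sym_mats"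
  shows "orth_proj S (A + B) = orth_proj S A + orth_proj S B"
  using assms
  by (intro orth_proj_eqI)
    (auto simp: orth_proj_inner inner_right_distrib intro: subspace_add orth_proj_in subspace_sym_mats)

text \<open>Stated for a general \<open>M\<close> so that it covers both \<open>Y\<close> with
  \<open>L\<close> and \<open>C\<close> with \<open>sym_perp L\<close>. Invariance puts
  \<open>orth_proj S A\<close> in the same coset of \<open>M\<close> as \<open>A\<close>; by
  additivity, comparing the images of \<open>A + Z\<close> and \<open>A\<close> then isolates
  \<open>orth_proj S Z\<close>.\<close>

lemma affine_invariance:
  assumes S: "subspace S" "S \<subseteq> sym_mats" and M: "subspace M" "M \<subseteq> sym_mats"
    and A: "A \<in> sym_mats" and inv: "orth_proj S ` ((+) A ` M) \<subseteq> (+) A ` M"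
  shows affine_invariance_linear: "Z \<in> M \<Longrightarrow> orth_proj S Z \<in> M"
    and affine_slice: "((+) A ` M) \<inter> S = (+) (orth_proj S A) ` (M \<inter> S)"
proof -
  have step: "orth_proj S (A + Z) - A \<in> M" if "Z \<in> M" for Z
    using inv that by force
  have base: "orth_proj S A - A \<in> M"
    using step[of 0] M(1) by (simp add: subspace_0)
  show "orth_proj S Z \<in> M" if "Z \<in> M"
    using subspace_diff[OF M(1) step[OF that] base] that M(2) A
    by (auto simp: orth_proj_add[OF S])
  have PA: "orth_proj S A \<in> S" by (rule orth_proj_in[OF S A])
  \<comment> \<open>By \<open>base\<close> the two base points represent one coset of
    \<open>M\<close>; by \<open>PA\<close> the new one lies in \<open>S\<close>, so subtracting it
    also preserves membership in \<open>S\<close>.\<close>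
  have "X - A \<in> M \<longleftrightarrow> X - orth_proj S A \<in> M" for X
    using subspace_add[OF M(1) _ base, of "X - orth_proj S A"]
      subspace_diff[OF M(1) _ base, of "X - A"] by auto
  moreover have "X \<in> S \<longleftrightarrow> X - orth_proj S A \<in> S" for X
    using subspace_add[OF S(1) _ PA, of "X - orth_proj S A"]
      subspace_diff[OF S(1) _ PA, of X] by auto
  moreover have "X \<in> (+) B ` N \<longleftrightarrow> X - B \<in> N" for X B and N :: "(real^'n^'n) set"
    by (force simp: image_iff)
  ultimately show "((+) A ` M) \<inter> S = (+) (orth_proj S A) ` (M \<inter> S)"
    by blast
qed

text \<open>For the forward inclusion, the projected rank-one matrix is an admissible test by
  invariance, and \<open>X\<close> in \<open>S\<close> pairs with it as with the original. The
  converse is the nonnegativity of pairings between semidefinite matrices.\<close>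

lemma dual_cone_psd_slice:
  fixes S :: "(real^'n^'n) set"
  assumes S: "subspace S" "S \<subseteq> sym_mats" and inv: "orth_proj S ` psd_cone \<subseteq> psd_cone"
  shows "dual_cone (psd_cone \<inter> S) \<inter> S = psd_cone \<inter> S"
proof (intro equalityI subsetI)
  fix X assume X: "X \<in> dual_cone (psd_cone \<inter> S) \<inter> S"
  have "0 \<le> v \<bullet> (X *v v)" for v
  proof -
    let ?P = "orth_proj S (outer_square v)"
    have "?P \<in> psd_cone \<inter> S"
      using inv outer_square_psd orth_proj_in[OF S outer_square_sym] by blast
    then have "0 \<le> X \<bullet> ?P"
      using X by (auto simp: dual_cone_def trace_inner_eq_inner)
    also have "\<dots> = v \<bullet> (X *v v)"
      using X by (simp add: orth_proj_inner[OF S outer_square_sym] inner_outer_square)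
    finally show ?thesis .
  qed
  then show "X \<in> psd_cone \<inter> S"
    using X S(2) by (auto simp: psd_cone_def)
next
  fix X assume "X \<in> psd_cone \<inter> S"
  then show "X \<in> dual_cone (psd_cone \<inter> S) \<inter> S"
    using S(2) by (auto simp: dual_cone_def trace_inner_eq_inner psd_inner_nonneg)
qed

text \<open>Orthogonality to \<open>Z\<close> in \<open>L\<close> follows from orthogonality to its
  projection, which \<open>inv\<close> places in \<open>L \<inter> S\<close>. The other inclusion
  merely drops tests.\<close>

lemma sym_perp_slice:
  assumes S: "subspace S" "S \<subseteq> sym_mats" and "L \<subseteq> sym_mats"
    and inv: "\<And>Z. Z \<in> L \<Longrightarrow> orth_proj S Z \<in> L"
  shows "sym_perp (L \<inter> S) \<inter> S = sym_perp L \<inter> S"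
proof (intro equalityI subsetI)
  fix X assume X: "X \<in> sym_perp (L \<inter> S) \<inter> S"
  have "X \<bullet> Z = 0" if Z: "Z \<in> L" for Z
  proof -
    have "Z \<in> sym_mats" using Z assms(3) by blast
    note P = orth_proj_in[OF S this] orth_proj_inner[OF S this, of X]
    then have "X \<bullet> orth_proj S Z = 0"
      using X inv[OF Z] by (auto simp: sym_perp_def trace_inner_eq_inner)
    then show ?thesis using P X by simp
  qed
  then show "X \<in> sym_perp L \<inter> S"
    using X by (auto simp: sym_perp_def trace_inner_eq_inner)
qed (auto simp: sym_perp_def)

theorem proposition2p3:
  fixes L S :: "(real^'n^'n) set" and C Y :: "real^'n^'n"
  assumes "subspace L" "L \<subseteq> sym_mats"
    and "C \<in> sym_mats" "Y \<in> sym_mats"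
    and "subspace S" "S \<subseteq> sym_mats"
    and "constraint_set_invariance (orth_proj S) C Y L"
  shows "primal_dual_pair S
           (Minimize (orth_proj S C) (orth_proj S Y) (L \<inter> S) (psd_cone \<inter> S))
           (Maximize (- orth_proj S Y) (orth_proj S C) (sym_perp L \<inter> S) (psd_cone \<inter> S)) \<and>
         dual_cone (psd_cone \<inter> S) \<inter> S = psd_cone \<inter> S \<and>
         sym_perp (L \<inter> S) \<inter> S = sym_perp L \<inter> S \<and>
         ((+) Y ` L) \<inter> S = (+) (orth_proj S Y) ` (L \<inter> S) \<and>
         ((+) C ` sym_perp L) \<inter> S = (+) (orth_proj S C) ` (sym_perp L \<inter> S)"
proof -
  note S = \<open>subspace S\<close> \<open>S \<subseteq> sym_mats\<close>
  note L = \<open>subspace L\<close> \<open>L \<subseteq> sym_mats\<close>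
  have inv: "orth_proj S ` psd_cone \<subseteq> psd_cone"
    "orth_proj S ` ((+) Y ` L) \<subseteq> (+) Y ` L"
    "orth_proj S ` ((+) C ` sym_perp L) \<subseteq> (+) C ` sym_perp L"
    using assms(7) by (simp_all add: constraint_set_invariance_def)
  have perp_sym: "sym_perp L \<subseteq> sym_mats" by (auto simp: sym_perp_def)
  have "dual_cone (psd_cone \<inter> S) \<inter> S = psd_cone \<inter> S"
    by (rule dual_cone_psd_slice[OF S inv(1)])
  \<comment> \<open>Invariance of \<open>L\<close> itself is extracted from that of its translate by
    \<open>Y\<close>.\<close>
  moreover have "sym_perp (L \<inter> S) \<inter> S = sym_perp L \<inter> S"
    by (intro sym_perp_slice S L(2) affine_invariance_linear[OF S L \<open>Y \<in> sym_mats\<close> inv(2)])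
  moreover have "((+) Y ` L) \<inter> S = (+) (orth_proj S Y) ` (L \<inter> S)"
    by (rule affine_slice[OF S L \<open>Y \<in> sym_mats\<close> inv(2)])
  moreover have "((+) C ` sym_perp L) \<inter> S = (+) (orth_proj S C) ` (sym_perp L \<inter> S)"
    by (rule affine_slice[OF S subspace_sym_perp perp_sym \<open>C \<in> sym_mats\<close> inv(3)])
  moreover have "subspace (L \<inter> S)" by (intro subspace_inter L S)
  moreover have "orth_proj S C \<in> S" "orth_proj S Y \<in> S"
    by (intro orth_proj_in S assms)+
  ultimately show ?thesis by simp
qed

end
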